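(* For $w\in\mathrm{int}\,\mathcal{K}$ and $\mu>0$, let $d=d_N(w,\mu)$ and define \[ x:=\sqrt\mu\,w,\quad s:=\sqrt\mu\,w^{-1},\quad d_x:=\sqrt\mu\,Q(w^{1/2})d,\quad d_s:=-\sqrt\mu\,Q(w^{-1/2})d . \] Then $d_x$ and $d_s$ are the unique points in $\mathcal{J}$ satisfying \[ x+d_x\in x_0+\mathcal{L},\qquad s+d_s\in s_0+\mathcal{L}^\perp,\qquad d_s=-\mu\,Q(x)^{-1}d_x . \] Further, $\|d\|=\|d_x\|_x$ and $\|d\|=\|d_s\|_s$.
   Context: Setting. $\mathcal{J}$ is a (finite-dimensional real) Euclidean Jordan algebra of rank $n$ with product $\circ$, identity $e$, trace $\mathrm{tr}$, inner product $\langle u,v\rangle=\mathrm{tr}(u\circ v)$ and norm $\|u\|=\sqrt{\langle u,u\rangle}$. $\mathcal{K}=\{u\circ u:u\in\mathcal{J}\}$ is its cone of squares, with interior $\mathrm{int}\,\mathcal{K}$. Functions such as $u^{1/2}$, $u^{-1}$ are applied spectrally. $Q(u)v:=2u\circ(u\circ v)-(u\circ u)\circ v$; for $u\in\mathrm{int}\,\mathcal{K}$ it is self-adjoint positive definite and the local norm at $u$ is $\|v\|_u:=\|Q(u)^{-1/2}v\|$. $\mathcal{L}\subseteq\mathcal{J}$ is a linear subspace with orthogonal complement $\mathcal{L}^\perp$, and $x_0,s_0\in\mathcal{J}$. Standing assumption (Slater): $\mathrm{int}\,\mathcal{K}\cap(x_0+\mathcal{L})\neq\emptyset$ and $\mathrm{int}\,\mathcal{K}\cap(s_0+\mathcal{L}^\perp)\ne\emptyset$.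 Newton direction. For $w\in\mathrm{int}\,\mathcal{K}$ and $\mu>0$, $d_N(w,\mu)$ is the unique $d\in\mathcal{J}$ with $Q(w^{1/2})(e+d)\in\frac1{\sqrt\mu}x_0+\mathcal{L}$ and $Q(w^{-1/2})(e-d)\in\frac1{\sqrt\mu}s_0+\mathcal{L}^\perp$. *)

theory Defs
  imports "HOL-Analysis.Analysis"
begin

class jordan_ops = euclidean_space +
  fixes jprod :: "'a \<Rightarrow> 'a \<Rightarrow> 'a"  (infixl "\<odot>" 70)
    and jone :: 'a  ("\<e>")

definition (in jordan_ops) idempotent :: "'a \<Rightarrow> bool" where
  "idempotent c \<longleftrightarrow> c \<odot> c = c"

definition (in jordan_ops) primitive_idempotent :: "'a \<Rightarrow> bool" where
  "primitive_idempotent c \<longleftrightarrow> idempotent c \<and> c \<noteq> 0 \<and>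
     \<not> (\<exists>a b. idempotent a \<and> idempotent b \<and> a \<noteq> 0 \<and> b \<noteq> 0 \<and> c = a + b)"

definition (in jordan_ops) jordan_frame :: "'a set \<Rightarrow> bool" where
  "jordan_frame C \<longleftrightarrow> finite C \<and> (\<forall>c\<in>C. primitive_idempotent c) \<and>
     (\<forall>c\<in>C. \<forall>c'\<in>C. c \<noteq> c' \<longrightarrow> c \<odot> c' = 0) \<and> \<Sum>C = \<e>"

text \<open>\<open>spectral_decomp u C l\<close>: the Jordan frame \<open>C\<close> diagonalises \<open>u\<close>, and \<open>l c\<close> is the
  eigenvalue of \<open>u\<close> belonging to \<open>c\<close>; eigenvalues may repeat.\<close>

definition (in jordan_ops) spectral_decomp :: "'a \<Rightarrow> 'a set \<Rightarrow> ('a \<Rightarrow> real) \<Rightarrow> bool" where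
  "spectral_decomp u C l \<longleftrightarrow> jordan_frame C \<and> u = (\<Sum>c\<in>C. l c *\<^sub>R c)"

text \<open>In a Euclidean Jordan algebra every element has a spectral decomposition, and neither of
  the values described below depends on the one chosen.\<close>

definition (in jordan_ops) jtrace :: "'a \<Rightarrow> real" where
  "jtrace u = (THE t. \<exists>C l. spectral_decomp u C l \<and> t = (\<Sum>c\<in>C. l c))"

definition (in jordan_ops) spectral_map :: "(real \<Rightarrow> real) \<Rightarrow> 'a \<Rightarrow> 'a" where
  "spectral_map f u = (THE v. \<exists>C l. spectral_decomp u C l \<and> v = (\<Sum>c\<in>C. f (l c) *\<^sub>R c))"

text \<open>A Euclidean Jordan algebra carries an associative inner product; as usual it is normalised
  to be the trace inner product. Hence \<open>\<bullet>\<close>, \<open>norm\<close>, orthogonality and the topology of the type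
  are those of the trace inner product. (A \<open>euclidean_space\<close> is never zero-dimensional, so the
  trivial algebra is excluded.)\<close>

class euclidean_jordan_algebra = jordan_ops +
  assumes jprod_add_left: "(u + v) \<odot> w = u \<odot> w + v \<odot> w"
    and jprod_scaleR_left: "(r *\<^sub>R u) \<odot> v = r *\<^sub>R (u \<odot> v)"
    and jprod_commute: "u \<odot> v = v \<odot> u"
    and jordan_identity: "(u \<odot> u) \<odot> (u \<odot> v) = u \<odot> ((u \<odot> u) \<odot> v)"
    and jone_left: "\<e> \<odot> u = u"
    and inner_jprod: "(u \<odot> v) \<bullet> w = v \<bullet> (u \<odot> w)"
    and inner_eq_jtrace: "u \<bullet> v = jtrace (u \<odot> v)"

primrec jpow :: "'a::jordan_ops \<Rightarrow> nat \<Rightarrow> 'a" where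
  "jpow u 0 = \<e>"
| "jpow u (Suc k) = u \<odot> jpow u k"

text \<open>The degree of an element is the degree of its minimal polynomial.\<close>

definition jdegree :: "'a::jordan_ops \<Rightarrow> nat" where
  "jdegree u = (LEAST k. jpow u k \<in> span (jpow u ` {..<k}))"

definition jrank :: "'a::jordan_ops itself \<Rightarrow> nat" where
  "jrank TYPE('a) = Max (range (jdegree :: 'a \<Rightarrow> nat))"

definition cone_of_squares :: "'a::jordan_ops set" where
  "cone_of_squares = {u \<odot> u | u. True}"

text \<open>The three functions below are meant for elements with positive eigenvalues, that is, for
  the interior of the cone of squares; elsewhere they take conventional values
  (\<open>inverse 0 = 0\<close>, \<open>sqrt (- t) = - sqrt t\<close>).\<close>

definition jsqrt :: "'a::jordan_ops \<Rightarrow> 'a" where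
  "jsqrt = spectral_map sqrt"

definition jinv :: "'a::jordan_ops \<Rightarrow> 'a" where
  "jinv = spectral_map inverse"

definition jinv_sqrt :: "'a::jordan_ops \<Rightarrow> 'a" where
  "jinv_sqrt = spectral_map (\<lambda>t. inverse (sqrt t))"

definition quad_rep :: "'a::jordan_ops \<Rightarrow> 'a \<Rightarrow> 'a" where
  "quad_rep u v = 2 *\<^sub>R (u \<odot> (u \<odot> v)) - (u \<odot> u) \<odot> v"

definition psd_operator :: "('a::real_inner \<Rightarrow> 'a) \<Rightarrow> bool" where
  "psd_operator A \<longleftrightarrow> linear A \<and> (\<forall>x y. A x \<bullet> y = x \<bullet> A y) \<and> (\<forall>x. 0 \<le> A x \<bullet> x)"

definition operator_sqrt :: "('a::real_inner \<Rightarrow> 'a) \<Rightarrow> 'a \<Rightarrow> 'a" where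
  "operator_sqrt A = (THE S. psd_operator S \<and> S \<circ> S = A)"

definition local_norm :: "'a::jordan_ops \<Rightarrow> 'a \<Rightarrow> real" where
  "local_norm u v = norm (operator_sqrt (inv (quad_rep u)) v)"

definition newton_direction :: "'a::jordan_ops set \<Rightarrow> 'a \<Rightarrow> 'a \<Rightarrow> 'a \<Rightarrow> real \<Rightarrow> 'a" where
  "newton_direction L x\<^sub>0 s\<^sub>0 w \<mu> = (THE d.
     quad_rep (jsqrt w) (\<e> + d) \<in> (+) ((1 / sqrt \<mu>) *\<^sub>R x\<^sub>0) ` L \<and>
     quad_rep (jinv_sqrt w) (\<e> - d) \<in> (+) ((1 / sqrt \<mu>) *\<^sub>R s\<^sub>0) ` (L\<^sup>\<bottom>))"

end

theory Submission
  imports Defs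
begin

text \<open>Linearising the Jordan identity shows that the multiplications by powers of a fixed element
  commute, so that element generates an associative subalgebra; its minimal ideals are
  one-dimensional, because self-adjoint multiplications have eigenvectors, and yield orthogonal
  idempotents. Refining these as far as possible gives the spectral decomposition, and Lagrange
  interpolation shows that the spectral functions do not depend on it. With respect to a fixed
  Jordan frame the Peirce projections diagonalise all \<open>Q(\<Sum> a\<^sub>i c\<^sub>i)\<close> simultaneously, so
  \<open>A = Q(w\<^sup>1\<^sup>/\<^sup>2)\<close> is positive semidefinite with inverse \<open>B = Q(w\<^sup>-\<^sup>1\<^sup>/\<^sup>2)\<close> and square \<open>Q(w)\<close>. The Newton
  system then asks to split a vector along the orthogonal sum of \<open>B L\<close> and \<open>(B L)\<^sup>\<bottom> = A (L\<^sup>\<bottom>)\<close>, and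
  the displayed system for \<open>(d\<^sub>x, d\<^sub>s)\<close> is the Newton system in the variable
  \<open>\<mu>\<^sup>-\<^sup>1\<^sup>/\<^sup>2 B d\<^sub>x\<close>.\<close>

section \<open>Linearised Jordan identity and powers\<close>

lemma jprod_add_right: "u \<odot> (v + w) = u \<odot> v + u \<odot> w" for u v w :: "'a::euclidean_jordan_algebra"
  by (metis jprod_add_left jprod_commute)

lemma jprod_scaleR_right: "u \<odot> (r *\<^sub>R v) = r *\<^sub>R (u \<odot> v)" for u v :: "'a::euclidean_jordan_algebra"
  by (metis jprod_scaleR_left jprod_commute)

lemma linear_jprod_right: "linear (\<lambda>v. u \<odot> v)" for u :: "'a::euclidean_jordan_algebra"
  by (rule linearI) (simp_all add: jprod_add_right jprod_scaleR_right)

lemma linear_jprod_left: "linear (\<lambda>v. v \<odot> u)" for u :: "'a::euclidean_jordan_algebra"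
  by (rule linearI) (simp_all add: jprod_add_left jprod_scaleR_left)

lemmas jprod_diff_right = linear_diff[OF linear_jprod_right]
lemmas jprod_diff_left = linear_diff[OF linear_jprod_left]
lemmas jprod_sum_right = linear_sum[OF linear_jprod_right]
lemmas jprod_sum_left = linear_sum[OF linear_jprod_left]
lemmas jprod_zero_right [simp] = linear_0[OF linear_jprod_right]
lemmas jprod_zero_left [simp] = linear_0[OF linear_jprod_left]
lemmas jprod_bilinear = jprod_add_left jprod_add_right jprod_diff_left jprod_diff_right
  jprod_scaleR_left jprod_scaleR_right

lemma jone_right [simp]: "u \<odot> \<e> = u" for u :: "'a::euclidean_jordan_algebra"
  by (metis jone_left jprod_commute)

text \<open>Polarisation: subtracting the Jordan identity for x - y from that for x + y keeps the
  terms of odd degree in y, and the case y removes the cubic one. Pairing with an arbitrary t turns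
  this into linear arithmetic over the reals.\<close>

lemma jordan_identity_linearized:
  fixes x y z :: "'a::euclidean_jordan_algebra"
  shows "((x \<odot> x) \<odot> z) \<odot> y =
    (x \<odot> x) \<odot> (z \<odot> y) + 2 *\<^sub>R ((x \<odot> z) \<odot> (x \<odot> y)) - 2 *\<^sub>R (x \<odot> (z \<odot> (x \<odot> y)))"
    (is "?l = ?r")
proof -
  have "?l \<bullet> t = ?r \<bullet> t" for t
  proof -
    note J = arg_cong[where f = "\<lambda>v. v \<bullet> t", OF jordan_identity]
    show ?thesis
      using J[of "x + y" z] J[of "x - y" z] J[of y z]
      by (simp add: jprod_bilinear jprod_commute inner_add_left inner_diff_left)
  qed
  then show ?thesis
    using vector_eq_rdot by blast
qed

text \<open>In terms of the multiplication operators L this reads [L(xx), L(y)] = 2 [L(x), L(xy)];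
  it makes orthogonal idempotents commute as operators.\<close>

lemma jordan_commutator:
  fixes x y z :: "'a::euclidean_jordan_algebra"
  shows "(x \<odot> x) \<odot> (y \<odot> z) - y \<odot> ((x \<odot> x) \<odot> z) = 2 *\<^sub>R (x \<odot> ((x \<odot> y) \<odot> z) - (x \<odot> y) \<odot> (x \<odot> z))"
  using jordan_identity_linearized[of x z y]
  by (simp add: jprod_commute scaleR_diff_right)

section \<open>Powers of a single element\<close>

lemma jpow_Suc_Suc: "jpow u (Suc (Suc k)) = (u \<odot> u) \<odot> jpow u k"
  for u :: "'a::euclidean_jordan_algebra"
proof (induction k)
  case 0
  show ?case by simp
next
  case (Suc k)
  then show ?case
    by (metis jordan_identity jpow.simps(2))
qed

text \<open>The linearised identity writes multiplication by the power k + 2 as a polynomial in the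
  multiplications by u, uu and the powers k and k + 1. Commuting with the first two therefore
  propagates to all powers.\<close>

lemma jpow_commutes_linear:
  fixes u :: "'a::euclidean_jordan_algebra"
  assumes T: "linear T"
    and 1: "\<And>z. T (u \<odot> z) = u \<odot> T z"
    and 2: "\<And>z. T ((u \<odot> u) \<odot> z) = (u \<odot> u) \<odot> T z"
  shows "T (jpow u k \<odot> z) = jpow u k \<odot> T z"
proof (induction k arbitrary: z rule: induct_nat_012)
  case 0
  show ?case by (simp add: jone_left)
next
  case 1
  show ?case by (simp add: assms(2))
next
  case (ge2 k)
  have rec: "jpow u (Suc (Suc k)) \<odot> y = (u \<odot> u) \<odot> (jpow u k \<odot> y)
      + 2 *\<^sub>R (jpow u (Suc k) \<odot> (u \<odot> y)) - 2 *\<^sub>R (u \<odot> (jpow u k \<odot> (u \<odot> y)))" for y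
    unfolding jpow_Suc_Suc using jordan_identity_linearized[of u "jpow u k" y] by simp
  show ?case
    unfolding rec
    by (simp only: linear_add[OF T] linear_diff[OF T] linear_scale[OF T] 1 2 ge2)
qed

text \<open>\<open>jpow_commutes_linear\<close> is applied three times: multiplications by u and by
  uu commute with each other, hence with those by all powers, so multiplication by a power meets the
  hypotheses in its turn.\<close>

lemma jpow_commute:
  fixes u :: "'a::euclidean_jordan_algebra"
  shows "jpow u m \<odot> (jpow u n \<odot> z) = jpow u n \<odot> (jpow u m \<odot> z)"
proof -
  have 1: "u \<odot> (jpow u m \<odot> z) = jpow u m \<odot> (u \<odot> z)" for z
    by (rule jpow_commutes_linear[OF linear_jprod_right]) (simp_all add: jordan_identity)
  have 2: "(u \<odot> u) \<odot> (jpow u m \<odot> z) = jpow u m \<odot> ((u \<odot> u) \<odot> z)" for z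
    by (rule jpow_commutes_linear[OF linear_jprod_right]) (simp_all add: jordan_identity)
  show ?thesis
    by (rule jpow_commutes_linear[OF linear_jprod_right]) (simp_all add: 1 2)
qed

lemma jpow_add: "jpow u m \<odot> jpow u n = jpow u (m + n)" for u :: "'a::euclidean_jordan_algebra"
proof (induction n)
  case (Suc n)
  show ?case
    using jpow_commute[of u m 1 "jpow u n"] Suc by simp
qed simp

text \<open>For z in A the last clause, together with commutativity of the product, says that A is
  associative.\<close>

definition commuting_subalgebra :: "'a::euclidean_jordan_algebra set \<Rightarrow> bool" where
  "commuting_subalgebra A \<longleftrightarrow> subspace A \<and> \<e> \<in> A \<and> (\<forall>a\<in>A. \<forall>b\<in>A. a \<odot> b \<in> A) \<and>
     (\<forall>a\<in>A. \<forall>b\<in>A. \<forall>z. a \<odot> (b \<odot> z) = b \<odot> (a \<odot> z))"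

lemma commuting_subalgebra_powers:
  "commuting_subalgebra (span (range (jpow u)))" (is "commuting_subalgebra ?A")
proof -
  have closed: "a \<odot> b \<in> ?A" if a: "a \<in> ?A" and b: "b \<in> ?A" for a b
  proof -
    have 1: "jpow u m \<odot> b \<in> ?A" for m
      using b
    proof (induction rule: span_induct)
      case base
      show ?case by (rule subspaceI) (simp_all add: jprod_bilinear span_zero span_add span_scale)
    next
      case (step x)
      then show ?case by (auto simp: jpow_add intro: span_base)
    qed
    show ?thesis
      using a
    proof (induction rule: span_induct)
      case base
      show ?case by (rule subspaceI) (simp_all add: jprod_bilinear span_zero span_add span_scale)
    next
      case (step x)
      then show ?case using 1 by auto
    qed
  qed
  have comm: "a \<odot> (b \<odot> z) = b \<odot> (a \<odot> z)" if a: "a \<in> ?A" and b: "b \<in> ?A" for a b z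
  proof -
    have 1: "jpow u m \<odot> (b \<odot> z) = b \<odot> (jpow u m \<odot> z)" for m
      using b
    proof (induction rule: span_induct)
      case base
      show ?case by (rule subspaceI) (simp_all add: jprod_bilinear)
    next
      case (step x)
      then show ?case by (auto simp: jpow_commute)
    qed
    show ?thesis
      using a
    proof (induction rule: span_induct)
      case base
      show ?case by (rule subspaceI) (simp_all add: jprod_bilinear)
    next
      case (step x)
      then show ?case using 1 by auto
    qed
  qed
  have "\<e> = jpow u 0" by simp
  then have "\<e> \<in> ?A" by (metis rangeI span_base)
  with closed comm show ?thesis
    unfolding commuting_subalgebra_def by (simp add: subspace_span)
qed

text \<open>A maximiser v of the Rayleigh quotient on the unit sphere of I is an eigenvector:
  otherwise moving v against the residual r = l v - T v, which stays in I, would exceed the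
  maximum.\<close>

lemma symmetric_operator_eigenvector:
  fixes T :: "'a::euclidean_space \<Rightarrow> 'a"
  assumes T: "linear T" and sym: "\<And>x y. T x \<bullet> y = x \<bullet> T y"
    and I: "subspace I" "I \<noteq> {0}" and inv: "\<And>v. v \<in> I \<Longrightarrow> T v \<in> I"
  obtains v l where "v \<in> I" "v \<noteq> 0" "T v = l *\<^sub>R v"
proof -
  let ?S = "sphere 0 1 \<inter> I"
  have "compact ?S"
    by (simp add: I(1) closed_subspace compact_Int_closed)
  moreover have "?S \<noteq> {}"
  proof -
    obtain y where y: "y \<in> I" "y \<noteq> 0" using I subspace_0 by blast
    then have "y /\<^sub>R norm y \<in> ?S" by (simp add: I(1) subspace_scale)
    then show ?thesis by blast
  qed
  moreover have "continuous_on ?S (\<lambda>v. T v \<bullet> v)"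
    by (intro continuous_intros linear_continuous_on linear_conv_bounded_linear[THEN iffD1] T)
  ultimately obtain v where v: "v \<in> ?S" and max: "\<And>y. y \<in> ?S \<Longrightarrow> T y \<bullet> y \<le> T v \<bullet> v"
    using continuous_attains_sup[of ?S "\<lambda>v. T v \<bullet> v"] by blast
  define l where "l = T v \<bullet> v"
  have vv: "v \<bullet> v = 1" using v by (simp add: norm_eq_1)
  have form: "T y \<bullet> y \<le> l * (y \<bullet> y)" if y: "y \<in> I" for y
  proof (cases "y = 0")
    case False
    then have "y /\<^sub>R norm y \<in> ?S" by (simp add: I(1) subspace_scale y)
    from max[OF this] have "T y \<bullet> y / (norm y * norm y) \<le> l"
      by (simp add: l_def linear_scale[OF T] divide_inverse mult.commute mult.left_commute)
    then show ?thesis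
      using False by (simp add: divide_le_eq dot_square_norm power2_eq_square split: if_splits)
  qed (simp add: linear_0[OF T])
  define r where "r = l *\<^sub>R v - T v"
  have rI: "r \<in> I" unfolding r_def using v by (simp add: I(1) inv subspace_diff subspace_scale)
  define b where "b = l * (r \<bullet> r) - T r \<bullet> r"
  \<comment> \<open>This is l (y . y) - T y . y at y = v + t r. The constant term vanishes by the
    choice of l, and the linear coefficient is 2 (r . r) since r = l v - T v.\<close>
  have quad: "0 \<le> 2 * t * (r \<bullet> r) + t\<^sup>2 * b" for t
  proof -
    have "v + t *\<^sub>R r \<in> I" using v rI by (simp add: I(1) subspace_add subspace_scale)
    from form[OF this]
    have "T v \<bullet> v + t * (T r \<bullet> v) + t * (T v \<bullet> r) + t * t * (T r \<bullet> r)
        \<le> l * (v \<bullet> v + 2 * t * (v \<bullet> r) + t * t * (r \<bullet> r))"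
      by (simp add: linear_add[OF T] linear_scale[OF T] inner_simps inner_commute algebra_simps)
    moreover have "T r \<bullet> v = T v \<bullet> r" by (metis sym inner_commute)
    moreover have "r \<bullet> r = l * (v \<bullet> r) - T v \<bullet> r" by (subst (1) r_def) (simp add: inner_simps)
    moreover have "2 * t * (l * (v \<bullet> r) - T v \<bullet> r) + t\<^sup>2 * b = l * (1 + 2 * t * (v \<bullet> r) + t * t * (r \<bullet> r))
        - (l + t * (T v \<bullet> r) + t * (T v \<bullet> r) + t * t * (T r \<bullet> r))"
      by (simp add: b_def power2_eq_square algebra_simps)
    ultimately show ?thesis
      using vv by (simp only: l_def[symmetric])
  qed
  have "r \<bullet> r = 0"
  proof (rule ccontr)
    assume "r \<bullet> r \<noteq> 0"
    then have rr: "r \<bullet> r > 0" by simp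
    \<comment> \<open>A negative t so small that |t b| is at most r . r; the linear term then
      dominates.\<close>
    define t where "t = - (r \<bullet> r) / (\<bar>b\<bar> + 1)"
    have "t < 0" using rr by (simp add: t_def divide_neg_pos)
    have "\<bar>t * b\<bar> \<le> r \<bullet> r"
      using rr mult_left_mono[of "\<bar>b\<bar>" "\<bar>b\<bar> + 1" "r \<bullet> r"]
      by (simp add: t_def abs_mult divide_le_eq)
    then have "0 < 2 * (r \<bullet> r) + t * b" using rr by linarith
    then have "t * (2 * (r \<bullet> r) + t * b) < 0" using \<open>t < 0\<close> by (rule mult_neg_pos[rotated])
    then show False using quad[of t] by (simp add: power2_eq_square algebra_simps)
  qed
  then have "T v = l *\<^sub>R v" by (simp add: r_def)
  moreover have "v \<noteq> 0" using vv by auto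
  ultimately show ?thesis using that v by blast
qed

section \<open>Orthogonal idempotents and spectral decompositions\<close>

text \<open>A Jordan frame without primitivity and without the sum condition, so that it also covers
  the systems met before refinement is complete. Excluding 0 makes the set linearly
  independent.\<close>

definition orthogonal_idempotents :: "'a::euclidean_jordan_algebra set \<Rightarrow> bool" where
  "orthogonal_idempotents C \<longleftrightarrow> finite C \<and> (\<forall>c\<in>C. idempotent c \<and> c \<noteq> 0) \<and>
     pairwise (\<lambda>c d. c \<odot> d = 0) C"

lemma inner_eq_inner_jone: "u \<bullet> v = (u \<odot> v) \<bullet> \<e>" for u v :: "'a::euclidean_jordan_algebra"
  by (metis inner_commute inner_jprod jone_right)

lemma jprod_self_eq_0_iff: "u \<odot> u = 0 \<longleftrightarrow> u = 0" for u :: "'a::euclidean_jordan_algebra"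
  using inner_eq_inner_jone[of u u] by auto

lemma independent_pairwise_jprod_0:
  fixes C :: "'a::euclidean_jordan_algebra set"
  assumes "pairwise (\<lambda>c d. c \<odot> d = 0) C" "0 \<notin> C"
  shows "independent C"
proof (rule pairwise_orthogonal_independent)
  show "pairwise orthogonal C"
    using assms(1) unfolding pairwise_def orthogonal_def
    by (metis inner_eq_inner_jone inner_zero_left)
qed (use assms in auto)

text \<open>An eigenspace of a multiplication inside I is again an ideal, since multiplications
  commute; by minimality it is all of I, so A acts on I by scalars. In particular vv = r v with r
  nonzero, and v / r is idempotent.\<close>

lemma minimal_ideal_one_dimensional:
  fixes A I :: "'a::euclidean_jordan_algebra set"
  assumes A: "commuting_subalgebra A" and I: "subspace I" "I \<subseteq> A" "I \<noteq> {0}"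
    and ideal: "\<And>a v. a \<in> A \<Longrightarrow> v \<in> I \<Longrightarrow> a \<odot> v \<in> I"
    and minimal: "\<And>J. subspace J \<Longrightarrow> J \<subseteq> I \<Longrightarrow> J \<noteq> {0} \<Longrightarrow>
      (\<And>a v. a \<in> A \<Longrightarrow> v \<in> J \<Longrightarrow> a \<odot> v \<in> J) \<Longrightarrow> J = I"
  obtains c where "c \<in> I" "idempotent c" "c \<noteq> 0" "\<And>a. a \<in> A \<Longrightarrow> \<exists>r. a \<odot> c = r *\<^sub>R c"
proof -
  have scalar: "\<exists>r. \<forall>v\<in>I. a \<odot> v = r *\<^sub>R v" if a: "a \<in> A" for a
  proof -
    obtain v r where v: "v \<in> I" "v \<noteq> 0" "a \<odot> v = r *\<^sub>R v"
      using symmetric_operator_eigenvector[OF linear_jprod_right inner_jprod I(1,3) ideal[OF a]]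
      by blast
    define J where "J = {y \<in> I. a \<odot> y = r *\<^sub>R y}"
    have "J = I"
    proof (rule minimal)
      show "subspace J"
        unfolding J_def using I(1)
        by (intro subspaceI)
          (auto simp: jprod_bilinear subspace_0 subspace_add subspace_scale scaleR_add_right)
      show "J \<subseteq> I" by (auto simp: J_def)
      show "J \<noteq> {0}" using v by (auto simp: J_def)
      show "b \<odot> y \<in> J" if "b \<in> A" "y \<in> J" for b y
        using that a A ideal
        by (auto simp: J_def commuting_subalgebra_def jprod_scaleR_right)
    qed
    then show ?thesis by (auto simp: J_def)
  qed
  obtain v where v: "v \<in> I" "v \<noteq> 0" using I subspace_0 by blast
  then obtain r where r: "v \<odot> v = r *\<^sub>R v" using scalar I by blast
  have "r \<noteq> 0" using r v jprod_self_eq_0_iff[of v] by auto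
  define c where "c = v /\<^sub>R r"
  show ?thesis
  proof (rule that)
    show cI: "c \<in> I" unfolding c_def using v I(1) by (simp add: subspace_scale)
    show "idempotent c" unfolding c_def idempotent_def
      using r \<open>r \<noteq> 0\<close> by (simp add: jprod_bilinear)
    show "c \<noteq> 0" using v \<open>r \<noteq> 0\<close> by (simp add: c_def)
    show "\<exists>r. a \<odot> c = r *\<^sub>R c" if "a \<in> A" for a
      using scalar[OF that] cI by blast
  qed
qed

text \<open>A nonzero ideal of least dimension inside B is minimal for inclusion.\<close>

lemma ideal_contains_atom:
  fixes A B :: "'a::euclidean_jordan_algebra set"
  assumes A: "commuting_subalgebra A" and B: "subspace B" "B \<subseteq> A" "B \<noteq> {0}"
    and ideal: "\<And>a v. a \<in> A \<Longrightarrow> v \<in> B \<Longrightarrow> a \<odot> v \<in> B"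
  obtains c where "c \<in> B" "idempotent c" "c \<noteq> 0" "\<And>a. a \<in> A \<Longrightarrow> \<exists>r. a \<odot> c = r *\<^sub>R c"
proof -
  define P where "P J \<longleftrightarrow> subspace J \<and> J \<subseteq> B \<and> J \<noteq> {0} \<and> (\<forall>a\<in>A. \<forall>v\<in>J. a \<odot> v \<in> J)" for J
  have "P B" using B ideal by (auto simp: P_def)
  then obtain I where I: "P I" and min: "\<And>J. P J \<Longrightarrow> dim I \<le> dim J"
    using ex_has_least_nat[of P B dim] by blast
  have eq: "J = I" if J: "subspace J" "J \<subseteq> I" "J \<noteq> {0}" "\<And>a v. a \<in> A \<Longrightarrow> v \<in> J \<Longrightarrow> a \<odot> v \<in> J" for J
  proof (rule subspace_dim_equal)
    have "P J" using I J by (auto simp: P_def)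
    then show "dim J \<ge> dim I" by (rule min)
  qed (use J I in \<open>auto simp: P_def\<close>)
  have prem: "subspace I" "I \<subseteq> A" "I \<noteq> {0}" "\<And>a v. a \<in> A \<Longrightarrow> v \<in> I \<Longrightarrow> a \<odot> v \<in> I"
    using I B by (auto simp: P_def)
  show ?thesis
    by (rule minimal_ideal_one_dimensional[OF A prem eq that]) (use I in \<open>auto simp: P_def\<close>)
qed

text \<open>C collects all nonzero idempotents of A on which A acts by scalars. What they leave
  uncovered is their annihilator in A; as an ideal it would, if nonzero, contain a further such
  idempotent, whose square would be 0.\<close>

lemma commuting_subalgebra_spanned:
  fixes A :: "'a::euclidean_jordan_algebra set"
  assumes A: "commuting_subalgebra A"
  obtains C where "orthogonal_idempotents C" "A \<subseteq> span C" "\<Sum>C = \<e>"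
proof -
  define C where "C = {c \<in> A. idempotent c \<and> c \<noteq> 0 \<and> (\<forall>a\<in>A. \<exists>r. a \<odot> c = r *\<^sub>R c)}"
  have orth: "c \<odot> d = 0" if "c \<in> C" "d \<in> C" "c \<noteq> d" for c d
  proof (rule ccontr)
    assume ne: "c \<odot> d \<noteq> 0"
    have "\<exists>r. c \<odot> d = r *\<^sub>R d" "\<exists>q. d \<odot> c = q *\<^sub>R c"
      using that by (auto simp: C_def)
    then obtain r q where r: "c \<odot> d = r *\<^sub>R d" and q: "d \<odot> c = q *\<^sub>R c" by blast
    \<comment> \<open>Associativity gives c(cd) = cd, so r = 1 and cd = d; symmetrically dc = c,
      whence c = d.\<close>
    have "c \<odot> (c \<odot> d) = (c \<odot> c) \<odot> d"
      using A that unfolding commuting_subalgebra_def C_def idempotent_def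
      by (metis (mono_tags, lifting) mem_Collect_eq jprod_commute)
    then have "r *\<^sub>R (c \<odot> d) = c \<odot> d"
      using that r by (simp add: jprod_bilinear C_def idempotent_def)
    then have "r = 1" using ne by (metis scaleR_cancel_right scaleR_one)
    have "d \<odot> (d \<odot> c) = (d \<odot> d) \<odot> c"
      using A that unfolding commuting_subalgebra_def C_def idempotent_def
      by (metis (mono_tags, lifting) mem_Collect_eq jprod_commute)
    then have "q *\<^sub>R (d \<odot> c) = d \<odot> c"
      using that q by (simp add: jprod_bilinear C_def idempotent_def)
    then have "q = 1" using ne by (metis scaleR_cancel_right scaleR_one jprod_commute)
    show False using r q \<open>r = 1\<close> \<open>q = 1\<close> that jprod_commute[of c d] by simp
  qed
  have pw: "pairwise (\<lambda>c d. c \<odot> d = 0) C" using orth by (auto simp: pairwise_def)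
  then have "independent C" by (rule independent_pairwise_jprod_0) (simp add: C_def)
  then have fin: "finite C" using independent_bound by blast
  then have C: "orthogonal_idempotents C"
    using pw by (auto simp: orthogonal_idempotents_def C_def)
  define B where "B = {a \<in> A. \<forall>c\<in>C. a \<odot> c = 0}"
  have "B = {0}"
  proof (rule ccontr)
    assume "B \<noteq> {0}"
    moreover have "subspace B"
      using A unfolding B_def commuting_subalgebra_def
      by (intro subspaceI) (auto simp: jprod_bilinear subspace_0 subspace_add subspace_scale)
    moreover have "a \<odot> v \<in> B" if "a \<in> A" "v \<in> B" for a v
    proof -
      have "(a \<odot> v) \<odot> c = 0" if c: "c \<in> C" for c
      proof -
        have "c \<odot> (a \<odot> v) = a \<odot> (c \<odot> v)"
          using A \<open>a \<in> A\<close> c by (auto simp: commuting_subalgebra_def C_def)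
        then show ?thesis using \<open>v \<in> B\<close> c by (simp add: B_def jprod_commute)
      qed
      then show ?thesis using that A by (auto simp: B_def commuting_subalgebra_def)
    qed
    moreover have "B \<subseteq> A" by (auto simp: B_def)
    ultimately obtain c where c: "c \<in> B" "idempotent c" "c \<noteq> 0"
      "\<And>a. a \<in> A \<Longrightarrow> \<exists>r. a \<odot> c = r *\<^sub>R c"
      using ideal_contains_atom[OF A, of B] by metis
    then have "c \<in> C" by (auto simp: C_def B_def)
    then have "c \<odot> c = 0" using c by (auto simp: B_def)
    then show False using c jprod_self_eq_0_iff by blast
  qed
  have expand: "\<exists>r. a = (\<Sum>c\<in>C. r c *\<^sub>R c) \<and> (\<forall>c\<in>C. a \<odot> c = r c *\<^sub>R c)" if a: "a \<in> A" for a
  proof -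
    have "\<forall>c\<in>C. \<exists>r. a \<odot> c = r *\<^sub>R c" using a by (auto simp: C_def)
    then obtain r where r: "\<And>c. c \<in> C \<Longrightarrow> a \<odot> c = r c *\<^sub>R c" by metis
    have "(\<Sum>d\<in>C. r d *\<^sub>R d) \<odot> c = r c *\<^sub>R c" if c: "c \<in> C" for c
    proof -
      have "(r d *\<^sub>R d) \<odot> c = (if d = c then r c *\<^sub>R c else 0)" if "d \<in> C" for d
        using c that orth[of d c] by (simp add: jprod_scaleR_left C_def idempotent_def)
      then have "(\<Sum>d\<in>C. r d *\<^sub>R d) \<odot> c = (\<Sum>d\<in>C. if d = c then r c *\<^sub>R c else 0)"
        unfolding jprod_sum_left by simp
      then show ?thesis using c fin by simp
    qed
    moreover have "(\<Sum>d\<in>C. r d *\<^sub>R d) \<in> A"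
      using A unfolding commuting_subalgebra_def
      by (auto intro!: subspace_sum subspace_scale simp: C_def)
    ultimately have "a - (\<Sum>d\<in>C. r d *\<^sub>R d) \<in> B"
      using a A r by (auto simp: B_def jprod_diff_left commuting_subalgebra_def subspace_diff)
    then show ?thesis using \<open>B = {0}\<close> r by auto
  qed
  have "A \<subseteq> span C"
  proof
    fix a assume "a \<in> A"
    then obtain r where "a = (\<Sum>c\<in>C. r c *\<^sub>R c)" using expand by blast
    then show "a \<in> span C" by (simp add: span_sum span_scale span_base)
  qed
  moreover have "\<Sum>C = \<e>"
  proof -
    have "\<e> \<in> A" using A by (simp add: commuting_subalgebra_def)
    then obtain r where r: "\<e> = (\<Sum>c\<in>C. r c *\<^sub>R c)" "\<And>c. c \<in> C \<Longrightarrow> \<e> \<odot> c = r c *\<^sub>R c"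
      using expand by blast
    have "\<e> = (\<Sum>c\<in>C. c)"
      by (subst r(1), rule sum.cong) (use r(2) in \<open>auto simp: jone_left\<close>)
    then show ?thesis by simp
  qed
  ultimately show ?thesis using that C by blast
qed

section \<open>Positivity of multiplication by an idempotent\<close>

text \<open>The linearised identity with x = z = c: multiplication by c is a root of 2 t^3 - 3 t^2 +
  t.\<close>

lemma idempotent_cubic:
  fixes c v :: "'a::euclidean_jordan_algebra"
  assumes "idempotent c"
  shows "c \<odot> v = 3 *\<^sub>R (c \<odot> (c \<odot> v)) - 2 *\<^sub>R (c \<odot> (c \<odot> (c \<odot> v)))"
  using jordan_identity_linearized[of c c v] assms
    scaleR_add_left[of 1 2 "c \<odot> (c \<odot> v)"]
  by (simp add: idempotent_def)

text \<open>The eigenvalues of multiplication by an idempotent are \<open>0\<close>, \<open>1/2\<close> and \<open>1\<close>; the two vectors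
  \<open>2c(cv) - cv\<close> and \<open>4(cv - c(cv))\<close> are the components of \<open>v\<close> for the last two.\<close>

lemma idempotent_inner_eq:
  fixes c v :: "'a::euclidean_jordan_algebra"
  assumes "idempotent c"
  shows "(c \<odot> v) \<bullet> v = (norm (2 *\<^sub>R (c \<odot> (c \<odot> v)) - c \<odot> v))\<^sup>2
    + (norm (4 *\<^sub>R (c \<odot> v - c \<odot> (c \<odot> v))))\<^sup>2 / 2"
proof -
  define p q r where "p = c \<odot> v" and "q = c \<odot> p" and "r = c \<odot> q"
  have "p = 3 *\<^sub>R q - 2 *\<^sub>R r"
    unfolding p_def q_def r_def by (rule idempotent_cubic[OF assms])
  then have r: "p \<bullet> t = 3 * (q \<bullet> t) - 2 * (r \<bullet> t)" for t by (metis inner_diff_left inner_scaleR_left)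
  have e: "p \<bullet> p = q \<bullet> v" "q \<bullet> p = r \<bullet> v" "p \<bullet> q = r \<bullet> v" "r \<bullet> p = q \<bullet> q"
    by (simp_all add: p_def q_def r_def inner_jprod inner_commute)
  have "(norm (2 *\<^sub>R q - p))\<^sup>2 = 4 * (q \<bullet> q) - 4 * (r \<bullet> v) + q \<bullet> v"
    by (simp add: power2_norm_eq_inner inner_diff_left inner_diff_right e)
  moreover have "(norm (4 *\<^sub>R (p - q)))\<^sup>2 = 16 * (q \<bullet> v - 2 * (r \<bullet> v) + q \<bullet> q)"
    by (simp add: power2_norm_eq_inner inner_diff_left inner_diff_right e)
  \<comment> \<open>The cubic relation paired with v and with p; the rest is elimination.\<close>
  moreover have "p \<bullet> v = 3 * (q \<bullet> v) - 2 * (r \<bullet> v)" "q \<bullet> v = 3 * (r \<bullet> v) - 2 * (q \<bullet> q)"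
    using r[of v] r[of p] by (simp_all add: e)
  ultimately have "p \<bullet> v = (norm (2 *\<^sub>R q - p))\<^sup>2 + (norm (4 *\<^sub>R (p - q)))\<^sup>2 / 2"
    by argo
  then show ?thesis by (simp only: p_def q_def)
qed

lemma idempotent_inner_nonneg:
  fixes c v :: "'a::euclidean_jordan_algebra"
  assumes "idempotent c"
  shows "0 \<le> (c \<odot> v) \<bullet> v"
  unfolding idempotent_inner_eq[OF assms] by simp

text \<open>Both squares in \<open>idempotent_inner_eq\<close> must vanish, and cv is a combination
  of the two components.\<close>

lemma idempotent_inner_eq_0:
  fixes c v :: "'a::euclidean_jordan_algebra"
  assumes "idempotent c" "(c \<odot> v) \<bullet> v = 0"
  shows "c \<odot> v = 0"
proof -
  define p q where "p = 2 *\<^sub>R (c \<odot> (c \<odot> v)) - c \<odot> v" and "q = 4 *\<^sub>R (c \<odot> v - c \<odot> (c \<odot> v))"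
  have "(norm p)\<^sup>2 + (norm q)\<^sup>2 / 2 = 0"
    using idempotent_inner_eq[OF assms(1), of v] assms(2) by (simp only: p_def q_def)
  then have "p = 0" "q = 0" by (simp_all add: add_nonneg_eq_0_iff)
  then have "c \<odot> v = 2 *\<^sub>R (c \<odot> (c \<odot> v))" "c \<odot> v = c \<odot> (c \<odot> v)" by (simp_all add: p_def q_def)
  then have "c \<odot> v = 2 *\<^sub>R (c \<odot> v)" by metis
  then show ?thesis by (simp add: scaleR_2)
qed

text \<open>This presents the inner product of a and b as the quadratic form of multiplication by a,
  evaluated at b; for idempotent a the positivity results then apply to it.\<close>

lemma idempotent_inner_jprod:
  fixes a b :: "'a::euclidean_jordan_algebra"
  assumes "idempotent b"
  shows "(a \<odot> b) \<bullet> b = a \<bullet> b"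
proof -
  have "(a \<odot> b) \<bullet> b = (b \<odot> a) \<bullet> b" by (simp only: jprod_commute)
  also have "\<dots> = a \<bullet> (b \<odot> b)" by (rule inner_jprod)
  finally show ?thesis using assms by (simp add: idempotent_def)
qed

lemma idempotents_inner_nonneg:
  fixes a b :: "'a::euclidean_jordan_algebra"
  assumes "idempotent a" "idempotent b"
  shows "0 \<le> a \<bullet> b"
  using idempotent_inner_nonneg[OF assms(1), of b] idempotent_inner_jprod[OF assms(2), of a] by simp

lemma idempotents_inner_eq_0:
  fixes a b :: "'a::euclidean_jordan_algebra"
  assumes "idempotent a" "idempotent b" "a \<bullet> b = 0"
  shows "a \<odot> b = 0"
  using idempotent_inner_eq_0[OF assms(1), of b] idempotent_inner_jprod[OF assms(2), of a] assms(3)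
  by simp

text \<open>If c = a + b, then cc = c forces ab = 0. For any other x in C the inner products of x
  with a and b are nonnegative and add up to that with c, which is 0, so a and b annihilate x and
  may replace c.\<close>

lemma orthogonal_idempotents_refine:
  fixes c :: "'a::euclidean_jordan_algebra"
  assumes C: "orthogonal_idempotents C" and c: "c \<in> C" "\<not> primitive_idempotent c"
  obtains D where "orthogonal_idempotents D" "\<Sum>D = \<Sum>C" "span C \<subseteq> span D" "card D = Suc (card C)"
proof -
  have fin: "finite C" and idC: "\<And>x. x \<in> C \<Longrightarrow> idempotent x \<and> x \<noteq> 0"
    and pw: "\<And>x y. x \<in> C \<Longrightarrow> y \<in> C \<Longrightarrow> x \<noteq> y \<Longrightarrow> x \<odot> y = 0"
    using C by (auto simp: orthogonal_idempotents_def pairwise_def)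
  obtain a b where ab: "idempotent a" "idempotent b" "a \<noteq> 0" "b \<noteq> 0" "c = a + b"
    using c idC by (auto simp: primitive_idempotent_def)
  have "c \<odot> c = c" using c idC by (auto simp: idempotent_def)
  moreover have "c \<odot> c = c + 2 *\<^sub>R (a \<odot> b)"
    using ab by (simp add: jprod_bilinear idempotent_def jprod_commute[of b a] scaleR_2)
  ultimately have "2 *\<^sub>R (a \<odot> b) = 0" by simp
  then have ab0: "a \<odot> b = 0" by simp
  have orth: "a \<odot> x = 0 \<and> b \<odot> x = 0" if x: "x \<in> C" "x \<noteq> c" for x
  proof -
    have "c \<bullet> x = 0" using pw[of c x] c x inner_eq_inner_jone[of c x] by simp
    then have "a \<bullet> x + b \<bullet> x = 0" using ab by (simp add: inner_add_left)
    moreover have "0 \<le> a \<bullet> x" "0 \<le> b \<bullet> x" using ab x idC by (auto intro: idempotents_inner_nonneg)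
    ultimately have "a \<bullet> x = 0" "b \<bullet> x = 0" by linarith+
    then show ?thesis using ab x idC by (auto intro: idempotents_inner_eq_0)
  qed
  \<comment> \<open>Each coincidence would give aa = 0 or bb = 0. Distinctness keeps the sum and the
    cardinality of D right.\<close>
  have nin: "a \<notin> C - {c}" "b \<notin> C - {c}" "a \<noteq> b"
    using orth ab ab0 by (auto simp: idempotent_def)
  define D where "D = insert a (insert b (C - {c}))"
  show ?thesis
  proof (rule that)
    show "orthogonal_idempotents D"
      unfolding orthogonal_idempotents_def D_def pairwise_insert
      using fin idC ab ab0 orth pw by (auto simp: pairwise_def jprod_commute)
    have "\<Sum>D = c + \<Sum>(C - {c})" using nin fin ab by (simp add: D_def add.assoc)
    then show "\<Sum>D = \<Sum>C" using c fin by (simp add: sum.remove)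
    show "card D = Suc (card C)"
      using nin fin c by (simp add: D_def card_Suc_Diff1 del: card_Diff_insert)
    have "x \<in> span D" if "x \<in> C" for x
      using that ab by (cases "x = c") (auto simp: D_def intro: span_base span_add)
    then show "span C \<subseteq> span D" by (simp add: span_minimal subsetI)
  qed
qed

text \<open>The powers of u supply one system of orthogonal idempotents that sums to the identity
  and spans u. Independence bounds the size of such systems by the dimension, and in a largest one
  nothing can be refined, so every member is primitive.\<close>

lemma spectral_decomp_exists:
  fixes u :: "'a::euclidean_jordan_algebra"
  obtains C l where "spectral_decomp u C l"
proof -
  define P where "P C \<longleftrightarrow> orthogonal_idempotents C \<and> \<Sum>C = \<e> \<and> u \<in> span C" for C
  have "jpow u 1 \<in> span (range (jpow u))" by (rule span_base) blast
  then have "u \<in> span (range (jpow u))" by simp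
  then obtain C\<^sub>0 where "P C\<^sub>0"
    using commuting_subalgebra_spanned[OF commuting_subalgebra_powers[of u]]
    unfolding P_def by blast
  moreover have "\<forall>C. P C \<longrightarrow> card C < Suc DIM('a)"
  proof (intro allI impI)
    fix C assume "P C"
    then have "independent C"
      by (intro independent_pairwise_jprod_0) (auto simp: P_def orthogonal_idempotents_def)
    then show "card C < Suc DIM('a)" using independent_bound less_Suc_eq_le by blast
  qed
  ultimately have "\<exists>C. P C \<and> (\<forall>D. P D \<longrightarrow> card D \<le> card C)"
    by (rule ex_has_greatest_nat[where P = P and f = card])
  then obtain C where C: "P C" and max: "\<And>D. P D \<Longrightarrow> card D \<le> card C" by auto
  have prim: "primitive_idempotent c" if "c \<in> C" for c
  proof (rule ccontr)
    assume "\<not> primitive_idempotent c"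
    moreover have oC: "orthogonal_idempotents C" "\<Sum>C = \<e>" "u \<in> span C" using C by (auto simp: P_def)
    ultimately obtain D where "orthogonal_idempotents D" "\<Sum>D = \<Sum>C" "span C \<subseteq> span D"
      and card: "card D = Suc (card C)"
      using orthogonal_idempotents_refine[OF _ \<open>c \<in> C\<close>] by blast
    then have "P D" using oC by (auto simp: P_def)
    then show False using max[of D] card by simp
  qed
  have fin: "finite C" using C by (simp add: P_def orthogonal_idempotents_def)
  have frame: "jordan_frame C"
    using C prim unfolding jordan_frame_def P_def orthogonal_idempotents_def pairwise_def by blast
  obtain l where "u = (\<Sum>c\<in>C. l c *\<^sub>R c)"
    using C span_finite[OF fin] unfolding P_def by auto
  then show ?thesis using that frame by (auto simp: spectral_decomp_def)
qed

section \<open>Spectral functions and the Peirce decomposition\<close>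

lemma jordan_frame_orthogonal_idempotents:
  fixes C :: "'a::euclidean_jordan_algebra set"
  assumes "jordan_frame C"
  shows "orthogonal_idempotents C" "\<Sum>C = \<e>"
  using assms
  by (auto simp: jordan_frame_def orthogonal_idempotents_def primitive_idempotent_def pairwise_def)

lemma orthogonal_idempotents_product:
  fixes C :: "'a::euclidean_jordan_algebra set"
  assumes C: "orthogonal_idempotents C"
  shows "(\<Sum>c\<in>C. a c *\<^sub>R c) \<odot> (\<Sum>c\<in>C. b c *\<^sub>R c) = (\<Sum>c\<in>C. (a c * b c) *\<^sub>R c)"
  unfolding jprod_sum_left
proof (rule sum.cong)
  fix c assume c: "c \<in> C"
  have fin: "finite C" using C by (simp add: orthogonal_idempotents_def)
  have "(a c *\<^sub>R c) \<odot> (b d *\<^sub>R d) = (if d = c then (a c * b c) *\<^sub>R c else 0)" if "d \<in> C" for d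
    using C c that
    by (auto simp: orthogonal_idempotents_def pairwise_def idempotent_def jprod_bilinear)
  then have "(a c *\<^sub>R c) \<odot> (\<Sum>d\<in>C. b d *\<^sub>R d) = (\<Sum>d\<in>C. if d = c then (a c * b c) *\<^sub>R c else 0)"
    unfolding jprod_sum_right by simp
  then show "(a c *\<^sub>R c) \<odot> (\<Sum>d\<in>C. b d *\<^sub>R d) = (a c * b c) *\<^sub>R c"
    using fin c by simp
qed simp

lemma jpow_spectral:
  fixes C :: "'a::euclidean_jordan_algebra set"
  assumes "orthogonal_idempotents C" "\<Sum>C = \<e>"
  shows "jpow (\<Sum>c\<in>C. l c *\<^sub>R c) k = (\<Sum>c\<in>C. (l c ^ k) *\<^sub>R c)"
  by (induction k) (simp_all add: assms orthogonal_idempotents_product)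

text \<open>Newton interpolation: a new node is met by adding a multiple of the polynomial q that
  vanishes at the old ones.\<close>

lemma interpolating_polynomial:
  fixes f :: "'a::field \<Rightarrow> 'a"
  assumes "finite S"
  obtains p where "\<And>x. x \<in> S \<Longrightarrow> poly p x = f x"
  using assms
proof (induction S arbitrary: thesis rule: finite_induct)
  case empty
  then show ?case by simp
next
  case (insert a S)
  obtain p where p: "\<And>x. x \<in> S \<Longrightarrow> poly p x = f x" using insert.IH by blast
  define q where "q = (\<Prod>s\<in>S. [:- s, 1:])"
  have 0: "poly q x = 0" if "x \<in> S" for x
    using that insert.hyps(1) by (auto simp: q_def poly_prod prod_zero_iff)
  have "poly q a \<noteq> 0"
    using insert.hyps by (auto simp: q_def poly_prod prod_zero_iff)
  then have "poly (p + smult ((f a - poly p a) / poly q a) q) x = f x" if "x \<in> insert a S" for x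
    using that p 0 by auto
  then show ?case using insert.prems by blast
qed

text \<open>Given two decompositions of u, let p interpolate f at the eigenvalues of both. Both
  candidate values then equal p(u), which is built from powers of u alone.\<close>

lemma spectral_map_eq:
  fixes u :: "'a::euclidean_jordan_algebra"
  assumes u: "spectral_decomp u C l"
  shows "spectral_map f u = (\<Sum>c\<in>C. f (l c) *\<^sub>R c)"
  unfolding spectral_map_def
proof (rule the_equality)
  show "\<exists>C' l'. spectral_decomp u C' l' \<and> (\<Sum>c\<in>C. f (l c) *\<^sub>R c) = (\<Sum>c\<in>C'. f (l' c) *\<^sub>R c)"
    using u by blast
next
  fix v assume "\<exists>C' l'. spectral_decomp u C' l' \<and> v = (\<Sum>c\<in>C'. f (l' c) *\<^sub>R c)"
  then obtain C' l' where u': "spectral_decomp u C' l'" and v: "v = (\<Sum>c\<in>C'. f (l' c) *\<^sub>R c)"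
    by blast
  have fin: "finite C" "finite C'"
    using u u' by (auto simp: spectral_decomp_def jordan_frame_def)
  then have "finite (l ` C \<union> l' ` C')" by simp
  then obtain p where p: "\<And>x. x \<in> l ` C \<union> l' ` C' \<Longrightarrow> poly p x = f x"
    by (rule interpolating_polynomial[where f = f]) metis
  have poly: "(\<Sum>i\<le>degree p. coeff p i *\<^sub>R jpow u i) = (\<Sum>c\<in>D. poly p (m c) *\<^sub>R c)"
    if D: "spectral_decomp u D m" for D m
  proof -
    have "u = (\<Sum>c\<in>D. m c *\<^sub>R c)" and "jordan_frame D" using D by (auto simp: spectral_decomp_def)
    then have pow: "jpow u i = (\<Sum>c\<in>D. (m c ^ i) *\<^sub>R c)" for i
      using jpow_spectral[OF jordan_frame_orthogonal_idempotents, of D m i] by simp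
    have "(\<Sum>i\<le>degree p. coeff p i *\<^sub>R jpow u i)
        = (\<Sum>i\<le>degree p. \<Sum>c\<in>D. (coeff p i * m c ^ i) *\<^sub>R c)"
      by (simp add: pow scaleR_sum_right)
    also have "\<dots> = (\<Sum>c\<in>D. \<Sum>i\<le>degree p. (coeff p i * m c ^ i) *\<^sub>R c)"
      by (rule sum.swap)
    finally show ?thesis by (simp add: poly_altdef scaleR_sum_left)
  qed
  have "v = (\<Sum>c\<in>C'. poly p (l' c) *\<^sub>R c)" unfolding v using p by simp
  also have "\<dots> = (\<Sum>c\<in>C. poly p (l c) *\<^sub>R c)" using poly[OF u] poly[OF u'] by simp
  also have "\<dots> = (\<Sum>c\<in>C. f (l c) *\<^sub>R c)" using p by simp
  finally show "v = (\<Sum>c\<in>C. f (l c) *\<^sub>R c)" .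
qed

text \<open>For small t > 0 the point w - t c is still a square yy, and (yy) . c = (cy) . y is
  nonnegative. As w . c = l(c) (c . c), this gives l(c) >= t.\<close>

lemma spectral_decomp_interior_pos:
  fixes w :: "'a::euclidean_jordan_algebra"
  assumes w: "w \<in> interior cone_of_squares" and dec: "spectral_decomp w C l" and c: "c \<in> C"
  shows "0 < l c"
proof -
  have C: "orthogonal_idempotents C" and wl: "w = (\<Sum>c\<in>C. l c *\<^sub>R c)"
    using dec jordan_frame_orthogonal_idempotents by (auto simp: spectral_decomp_def)
  have idc: "idempotent c" "c \<noteq> 0" and fin: "finite C" using C c by (auto simp: orthogonal_idempotents_def)
  obtain r where r: "r > 0" "ball w r \<subseteq> cone_of_squares" using w by (auto simp: mem_interior)
  define t where "t = r / (2 * norm c)"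
  have t: "t > 0" using r idc by (simp add: t_def)
  have "norm (t *\<^sub>R c) < r" using r idc by (simp add: t_def)
  then have "w - t *\<^sub>R c \<in> ball w r" by (simp add: dist_norm)
  then have "w - t *\<^sub>R c \<in> cone_of_squares" using r by blast
  then obtain y where y: "w - t *\<^sub>R c = y \<odot> y" unfolding cone_of_squares_def by blast
  have "(w - t *\<^sub>R c) \<bullet> c = (c \<odot> y) \<bullet> y"
    unfolding y by (metis inner_commute inner_jprod jprod_commute)
  then have nn: "0 \<le> (w - t *\<^sub>R c) \<bullet> c" using idempotent_inner_nonneg[OF idc(1)] by simp
  have "w \<bullet> c = (\<Sum>d\<in>C. if d = c then l c * (c \<bullet> c) else 0)"
    unfolding wl inner_sum_left
  proof (rule sum.cong)
    fix d assume "d \<in> C"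
    then show "(l d *\<^sub>R d) \<bullet> c = (if d = c then l c * (c \<bullet> c) else 0)"
      using C c inner_eq_inner_jone[of d c] by (auto simp: orthogonal_idempotents_def pairwise_def)
  qed simp
  then have "w \<bullet> c = l c * (c \<bullet> c)" using fin c by simp
  then have "0 \<le> (l c - t) * (c \<bullet> c)" using nn by (simp add: inner_diff_left algebra_simps)
  moreover have "c \<bullet> c > 0" using idc by simp
  ultimately show ?thesis using t by (smt (verit) mult_neg_pos)
qed

section \<open>Peirce decomposition\<close>

text \<open>For \<open>c = d\<close> this is the projection onto the Peirce space of \<open>c\<close>; for \<open>c \<noteq> d\<close> it is one half of
  the projection onto that of \<open>c\<close> and \<open>d\<close>, since the pairs \<open>(c, d)\<close> and \<open>(d, c)\<close> both occur in the
  sums below.\<close>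

definition peirce :: "'a::euclidean_jordan_algebra \<Rightarrow> 'a \<Rightarrow> 'a \<Rightarrow> 'a" where
  "peirce c d z = 2 *\<^sub>R (c \<odot> (d \<odot> z)) - (if c = d then c \<odot> z else 0)"

lemma orthogonal_idempotents_commute:
  fixes c d :: "'a::euclidean_jordan_algebra"
  assumes "idempotent c" "c \<odot> d = 0"
  shows "c \<odot> (d \<odot> z) = d \<odot> (c \<odot> z)"
  using jordan_commutator[of c d z] assms by (simp add: idempotent_def)

text \<open>With cd = 0 the linearised identity becomes c(dz) = 2 c(d(cz)), and c and d commute as
  operators. Thus c(dz) consists of eigenvalues 0 and 1/2 after one further multiplication by c: c
  acts on c(dz) as 1/2.\<close>

lemma orthogonal_idempotents_square:
  fixes c d :: "'a::euclidean_jordan_algebra"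
  assumes c: "idempotent c" "c \<odot> d = 0"
  shows "2 *\<^sub>R (c \<odot> (c \<odot> (d \<odot> z))) = c \<odot> (d \<odot> z)"
proof -
  have "c \<odot> (d \<odot> z) = 2 *\<^sub>R (c \<odot> (d \<odot> (c \<odot> z)))"
    using jordan_identity_linearized[of c d z] assms by (simp add: idempotent_def)
  then show ?thesis by (metis orthogonal_idempotents_commute[OF assms])
qed

text \<open>Applying \<open>orthogonal_idempotents_square\<close> to the idempotent c + d, and
  subtracting its instances for c and d, leaves only the cross terms, 4 c(d(fz)).\<close>

lemma orthogonal_idempotents_triple:
  fixes c d f :: "'a::euclidean_jordan_algebra"
  assumes c: "idempotent c" and d: "idempotent d"
    and orth: "c \<odot> d = 0" "c \<odot> f = 0" "d \<odot> f = 0"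
  shows "c \<odot> (d \<odot> (f \<odot> z)) = 0"
proof -
  have "idempotent (c + d)"
    using c d orth by (simp add: idempotent_def jprod_bilinear jprod_commute[of d c])
  moreover have "(c + d) \<odot> f = 0" using orth by (simp add: jprod_bilinear)
  ultimately have "2 *\<^sub>R ((c + d) \<odot> ((c + d) \<odot> (f \<odot> z))) = (c + d) \<odot> (f \<odot> z)"
    by (rule orthogonal_idempotents_square)
  then have "4 *\<^sub>R (c \<odot> (d \<odot> (f \<odot> z))) = 0"
    using orthogonal_idempotents_square[OF c orth(2), of z]
      orthogonal_idempotents_square[OF d orth(3), of z]
      orthogonal_idempotents_commute[OF c orth(1), of "f \<odot> z"]
      scaleR_left_distrib[of 2 2 "c \<odot> (d \<odot> (f \<odot> z))"]
    by (simp add: jprod_bilinear scaleR_add_right)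
  then show ?thesis by simp
qed

text \<open>The eigenvalue of f is half the number of its matches with c and d. The cubic relation
  settles c = d = f, the triple product settles three different idempotents, and
  \<open>orthogonal_idempotents_square\<close> settles the rest.\<close>

lemma peirce_eigenvector:
  fixes C :: "'a::euclidean_jordan_algebra set"
  assumes C: "orthogonal_idempotents C" and cd: "c \<in> C" "d \<in> C" "f \<in> C"
  shows "2 *\<^sub>R (f \<odot> peirce c d z) = ((if f = c then 1 else 0) + (if f = d then 1 else 0)) *\<^sub>R peirce c d z"
proof -
  have idem: "\<And>x. x \<in> C \<Longrightarrow> idempotent x"
    and orth: "\<And>x y. x \<in> C \<Longrightarrow> y \<in> C \<Longrightarrow> x \<noteq> y \<Longrightarrow> x \<odot> y = 0"
    using C by (auto simp: orthogonal_idempotents_def pairwise_def)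
  note [simp] = jprod_bilinear scaleR_diff_right
  consider "c = d" "f = c" | "c = d" "f \<noteq> c" | "c \<noteq> d" "f = c" | "c \<noteq> d" "f = d"
    | "c \<noteq> d" "f \<noteq> c" "f \<noteq> d" by blast
  then show ?thesis
  proof cases
    case 1
    have "4 *\<^sub>R (c \<odot> (c \<odot> (c \<odot> z))) = 6 *\<^sub>R (c \<odot> (c \<odot> z)) - 2 *\<^sub>R (c \<odot> z)"
      using arg_cong[OF idempotent_cubic[OF idem[OF cd(1)], of z], of "\<lambda>v. 2 *\<^sub>R v"]
      by (simp add: algebra_simps)
    then show ?thesis using 1
      scaleR_left_distrib[of 4 2 "c \<odot> (c \<odot> z)"] by (simp add: peirce_def algebra_simps)
  next
    case 2
    have "2 *\<^sub>R (c \<odot> (c \<odot> (f \<odot> z))) = c \<odot> (f \<odot> z)"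
      using cd 2 by (intro orthogonal_idempotents_square idem orth) auto
    moreover have comm: "f \<odot> (c \<odot> y) = c \<odot> (f \<odot> y)" for y
      using cd 2 by (intro orthogonal_idempotents_commute idem orth) auto
    ultimately show ?thesis using 2 by (simp add: peirce_def)
  next
    case 3
    have "2 *\<^sub>R (c \<odot> (c \<odot> (d \<odot> z))) = c \<odot> (d \<odot> z)"
      using cd 3 by (intro orthogonal_idempotents_square idem orth) auto
    then show ?thesis using 3 by (simp add: peirce_def)
  next
    case 4
    have "2 *\<^sub>R (d \<odot> (d \<odot> (c \<odot> z))) = d \<odot> (c \<odot> z)"
      using cd 4 by (intro orthogonal_idempotents_square idem orth) auto
    moreover have comm: "c \<odot> (d \<odot> y) = d \<odot> (c \<odot> y)" for y
      using cd 4 by (intro orthogonal_idempotents_commute idem orth) auto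
    ultimately show ?thesis using 4 by (simp add: peirce_def)
  next
    case 5
    have "f \<odot> (c \<odot> (d \<odot> z)) = 0"
      using cd 5 by (intro orthogonal_idempotents_triple idem orth) auto
    then show ?thesis using 5 by (simp add: peirce_def)
  qed
qed

text \<open>With u the weighted sum, the first terms of \<open>peirce\<close> add up to 2 u(uz) and
  the diagonal corrections to (uu)z.\<close>

lemma quad_rep_peirce_sum:
  fixes C :: "'a::euclidean_jordan_algebra set"
  assumes C: "orthogonal_idempotents C"
  shows "quad_rep (\<Sum>c\<in>C. a c *\<^sub>R c) z = (\<Sum>c\<in>C. \<Sum>d\<in>C. (a c * a d) *\<^sub>R peirce c d z)"
proof -
  have fin: "finite C" using C by (simp add: orthogonal_idempotents_def)
  have "(\<Sum>c\<in>C. \<Sum>d\<in>C. (a c * a d) *\<^sub>R peirce c d z)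
    = (\<Sum>c\<in>C. \<Sum>d\<in>C. (2 * a c * a d) *\<^sub>R (c \<odot> (d \<odot> z)))
      - (\<Sum>c\<in>C. \<Sum>d\<in>C. if c = d then (a c * a c) *\<^sub>R (c \<odot> z) else 0)"
    unfolding sum_subtractf[symmetric]
    by (intro sum.cong refl) (auto simp: peirce_def scaleR_diff_right)
  also have "(\<Sum>c\<in>C. \<Sum>d\<in>C. if c = d then (a c * a c) *\<^sub>R (c \<odot> z) else 0)
    = (\<Sum>c\<in>C. (a c * a c) *\<^sub>R (c \<odot> z))"
    using fin by simp
  also have "(\<Sum>c\<in>C. \<Sum>d\<in>C. (2 * a c * a d) *\<^sub>R (c \<odot> (d \<odot> z)))
    = 2 *\<^sub>R ((\<Sum>c\<in>C. a c *\<^sub>R c) \<odot> ((\<Sum>c\<in>C. a c *\<^sub>R c) \<odot> z))"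
  proof -
    have m: "(\<Sum>c\<in>C. a c *\<^sub>R c) \<odot> y = (\<Sum>c\<in>C. a c *\<^sub>R (c \<odot> y))" for y
      by (simp add: jprod_sum_left jprod_scaleR_left)
    show ?thesis
      unfolding m[of "(\<Sum>c\<in>C. a c *\<^sub>R c) \<odot> z"] unfolding m[of z]
      by (simp add: jprod_sum_right jprod_scaleR_right scaleR_sum_right mult.assoc)
  qed
  finally show ?thesis
    unfolding quad_rep_def orthogonal_idempotents_product[OF C]
    by (simp add: jprod_sum_left jprod_scaleR_left)
qed

text \<open>On the component of c and d, a weighted sum u acts as the mean of its two coefficients
  and uu as the mean of their squares; twice the squared mean minus the mean square is the
  product.\<close>

lemma quad_rep_peirce:
  fixes C :: "'a::euclidean_jordan_algebra set"
  assumes C: "orthogonal_idempotents C" and c: "c \<in> C" and d: "d \<in> C"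
  shows "quad_rep (\<Sum>c\<in>C. a c *\<^sub>R c) (peirce c d z) = (a c * a d) *\<^sub>R peirce c d z"
proof -
  have fin: "finite C" using C by (simp add: orthogonal_idempotents_def)
  have mult: "(\<Sum>f\<in>C. b f *\<^sub>R f) \<odot> peirce c d z = ((b c + b d) / 2) *\<^sub>R peirce c d z" for b :: "'a \<Rightarrow> real"
  proof -
    have "2 *\<^sub>R ((\<Sum>f\<in>C. b f *\<^sub>R f) \<odot> peirce c d z)
      = (\<Sum>f\<in>C. b f *\<^sub>R (2 *\<^sub>R (f \<odot> peirce c d z)))"
      by (simp add: jprod_sum_left jprod_scaleR_left scaleR_sum_right mult.commute)
    also have "\<dots> = (\<Sum>f\<in>C. (if f = c then b c else 0) + (if f = d then b d else 0)) *\<^sub>R peirce c d z"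
      unfolding scaleR_sum_left
      by (intro sum.cong refl) (simp add: peirce_eigenvector[OF C c d])
    also have "(\<Sum>f\<in>C. (if f = c then b c else 0) + (if f = d then b d else 0)) = b c + b d"
      using fin c d by (simp add: sum.distrib)
    finally have "(1/2) *\<^sub>R (2 *\<^sub>R ((\<Sum>f\<in>C. b f *\<^sub>R f) \<odot> peirce c d z)) = (1/2) *\<^sub>R ((b c + b d) *\<^sub>R peirce c d z)"
      by (rule arg_cong)
    then show ?thesis by simp
  qed
  have "quad_rep (\<Sum>c\<in>C. a c *\<^sub>R c) (peirce c d z)
    = (2 * ((a c + a d) / 2 * ((a c + a d) / 2)) - (a c * a c + a d * a d) / 2) *\<^sub>R peirce c d z"
    unfolding quad_rep_def orthogonal_idempotents_product[OF C]
    by (simp only: mult jprod_scaleR_right scaleR_scaleR scaleR_diff_left[symmetric] mult.assoc)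
  also have "2 * ((a c + a d) / 2 * ((a c + a d) / 2)) - (a c * a c + a d * a d) / 2 = a c * a d"
    by (simp add: field_simps)
  finally show ?thesis .
qed

section \<open>Algebra and positivity of the quadratic representation\<close>

lemma linear_quad_rep: "linear (quad_rep u)" for u :: "'a::euclidean_jordan_algebra"
  unfolding quad_rep_def
  by (rule linearI) (simp_all add: jprod_bilinear algebra_simps)

lemma quad_rep_symmetric: "quad_rep u v \<bullet> z = v \<bullet> quad_rep u z" for u :: "'a::euclidean_jordan_algebra"
  by (simp add: quad_rep_def inner_diff_left inner_diff_right inner_jprod)

lemma quad_rep_scaleR: "quad_rep (r *\<^sub>R u) v = r\<^sup>2 *\<^sub>R quad_rep u v"
  for u :: "'a::euclidean_jordan_algebra"
  by (simp add: quad_rep_def jprod_bilinear scaleR_diff_right power2_eq_square mult.left_commute)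

lemma quad_rep_jone: "quad_rep \<e> v = v" for v :: "'a::euclidean_jordan_algebra"
  by (simp add: quad_rep_def jone_left scaleR_2)

lemma quad_rep_of_jone: "quad_rep u \<e> = u \<odot> u" for u :: "'a::euclidean_jordan_algebra"
  by (simp add: quad_rep_def scaleR_2)

text \<open>After expanding the inner operator into Peirce components, the outer one merely scales
  each of them, so the coefficients multiply.\<close>

lemma quad_rep_compose:
  fixes C :: "'a::euclidean_jordan_algebra set"
  assumes C: "orthogonal_idempotents C"
  shows "quad_rep (\<Sum>c\<in>C. a c *\<^sub>R c) (quad_rep (\<Sum>c\<in>C. b c *\<^sub>R c) z)
    = quad_rep (\<Sum>c\<in>C. (a c * b c) *\<^sub>R c) z"
  unfolding quad_rep_peirce_sum[OF C, of b] quad_rep_peirce_sum[OF C, of "\<lambda>c. a c * b c"]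
    linear_sum[OF linear_quad_rep] linear_scale[OF linear_quad_rep]
  by (intro sum.cong refl) (simp add: quad_rep_peirce[OF C] mult_ac)

text \<open>Square roots of the coefficients give u with the operator equal to Q(u) Q(u), so its
  quadratic form is the squared norm of Q(u)x.\<close>

lemma psd_quad_rep:
  fixes C :: "'a::euclidean_jordan_algebra set"
  assumes C: "orthogonal_idempotents C" and a: "\<And>c. c \<in> C \<Longrightarrow> 0 \<le> a c"
  shows "psd_operator (quad_rep (\<Sum>c\<in>C. a c *\<^sub>R c))"
proof -
  define u where "u = (\<Sum>c\<in>C. sqrt (a c) *\<^sub>R c)"
  have "(\<Sum>c\<in>C. (sqrt (a c) * sqrt (a c)) *\<^sub>R c) = (\<Sum>c\<in>C. a c *\<^sub>R c)"
    using a by (intro sum.cong) auto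
  then have "quad_rep (\<Sum>c\<in>C. a c *\<^sub>R c) x = quad_rep u (quad_rep u x)" for x
    unfolding u_def quad_rep_compose[OF C] by simp
  then have "0 \<le> quad_rep (\<Sum>c\<in>C. a c *\<^sub>R c) x \<bullet> x" for x
    by (simp add: quad_rep_symmetric[of u "quad_rep u x" x])
  then show ?thesis
    by (simp add: psd_operator_def linear_quad_rep quad_rep_symmetric)
qed

section \<open>Uniqueness of positive semidefinite square roots\<close>

text \<open>If \<open>v\<close> is an eigenvector of \<open>D = S - T\<close> for an eigenvalue \<open>l \<noteq> 0\<close>, then
  \<open>D(S + T) + (S + T)D = 2(S\<^sup>2 - T\<^sup>2) = 0\<close> forces \<open>Sv \<bullet> v + Tv \<bullet> v = 0\<close>, hence \<open>Dv \<bullet> v = 0\<close>.\<close>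

lemma psd_sqrt_unique:
  fixes S T :: "'a::euclidean_space \<Rightarrow> 'a"
  assumes S: "psd_operator S" and T: "psd_operator T" and eq: "\<And>x. S (S x) = T (T x)"
  shows "S = T"
proof (rule ccontr)
  assume "S \<noteq> T"
  have lin: "linear S" "linear T" and sym: "\<And>x y. S x \<bullet> y = x \<bullet> S y" "\<And>x y. T x \<bullet> y = x \<bullet> T y"
    and nn: "\<And>x. 0 \<le> S x \<bullet> x" "\<And>x. 0 \<le> T x \<bullet> x"
    using S T by (auto simp: psd_operator_def)
  define D where "D x = S x - T x" for x
  have D: "linear D" unfolding D_def using lin by (rule linear_compose_sub)
  have symD: "D x \<bullet> y = x \<bullet> D y" for x y by (simp add: D_def inner_diff_left inner_diff_right sym)
  have "range D \<noteq> {0}"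
  proof
    assume "range D = {0}"
    then have "D x = 0" for x by blast
    then show False using \<open>S \<noteq> T\<close> by (auto simp: D_def)
  qed
  moreover have "subspace (range D)" by (simp add: D linear_subspace_image)
  ultimately obtain v l where v: "v \<in> range D" "v \<noteq> 0" "D v = l *\<^sub>R v"
    using symmetric_operator_eigenvector[OF D symD, of "range D"] by blast
  \<comment> \<open>Eigenvectors were sought in the range of D for this purpose: a symmetric
    operator has no nonzero kernel vector in its range.\<close>
  have "l \<noteq> 0"
  proof
    assume "l = 0"
    obtain y where "v = D y" using v by blast
    then have "v \<bullet> v = y \<bullet> D v" by (metis symD)
    then show False using v \<open>l = 0\<close> by simp
  qed
  have "S v \<bullet> S v = T v \<bullet> T v" by (metis sym eq)
  then have "(S v + T v) \<bullet> D v = 0"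
    by (simp add: D_def inner_diff_right inner_add_left) (simp add: inner_commute)
  then have "S v \<bullet> v + T v \<bullet> v = 0" using v \<open>l \<noteq> 0\<close> by (simp add: inner_add_left)
  then have "S v \<bullet> v = 0" "T v \<bullet> v = 0" using nn[of v] by auto
  then have "D v \<bullet> v = 0" by (simp add: D_def inner_diff_left)
  then show False using v \<open>l \<noteq> 0\<close> by simp
qed

lemma operator_sqrt_eqI:
  fixes S A :: "'a::euclidean_space \<Rightarrow> 'a"
  assumes "psd_operator S" "\<And>x. S (S x) = A x"
  shows "operator_sqrt A = S"
  unfolding operator_sqrt_def
proof (rule the_equality)
  show "psd_operator S \<and> S \<circ> S = A" using assms by auto
  show "T = S" if T: "psd_operator T \<and> T \<circ> T = A" for T
  proof (rule psd_sqrt_unique)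
    show "T (T x) = S (S x)" for x using T assms(2) by (metis comp_apply)
  qed (use T assms in auto)
qed

text \<open>With M = B L the two conditions place d in y + M and z - d in the orthogonal complement
  of M, where y = B a - p and z = p - A b. Splitting z - y orthogonally along M gives d.\<close>

lemma newton_system_unique_solution:
  fixes A B :: "'a::euclidean_space \<Rightarrow> 'a"
  assumes L: "subspace L" and A: "linear A" and B: "linear B"
    and AB: "\<And>v. A (B v) = v" and BA: "\<And>v. B (A v) = v"
    and symB: "\<And>u v. B u \<bullet> v = u \<bullet> B v"
  shows "\<exists>!d. A (p + d) \<in> (+) a ` L \<and> B (p - d) \<in> (+) b ` (L\<^sup>\<bottom>)"
proof -
  define M where "M = B ` L"
  have M: "subspace M" unfolding M_def using B L by (rule linear_subspace_image)
  have "A (p + d) \<in> (+) a ` L \<longleftrightarrow> d - (B a - p) \<in> M" for d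
  proof -
    have "A (p + d) \<in> (+) a ` L \<longleftrightarrow> A (p + d) - a \<in> L" 
      by (auto simp: image_iff algebra_simps intro: bexI[of _ "A (p + d) - a"])
    also have "\<dots> \<longleftrightarrow> B (A (p + d) - a) \<in> M"
      unfolding M_def by (metis AB imageE imageI)
    also have "B (A (p + d) - a) = d - (B a - p)" by (simp add: linear_diff[OF B] BA)
    finally show ?thesis .
  qed
  moreover have "B (p - d) \<in> (+) b ` (L\<^sup>\<bottom>) \<longleftrightarrow> (p - A b) - d \<in> M\<^sup>\<bottom>" for d
  proof -
    have "B (p - d) \<in> (+) b ` (L\<^sup>\<bottom>) \<longleftrightarrow> B (p - d) - b \<in> L\<^sup>\<bottom>"
      by (auto simp: image_iff algebra_simps intro: bexI[of _ "B (p - d) - b"])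
    also have "B (p - d) - b = B ((p - A b) - d)" by (simp add: linear_diff[OF B] BA)
    \<comment> \<open>Symmetry of B: B v is orthogonal to L exactly when v is orthogonal to B
      L.\<close>
    also have "B ((p - A b) - d) \<in> L\<^sup>\<bottom> \<longleftrightarrow> (p - A b) - d \<in> M\<^sup>\<bottom>"
      unfolding orthogonal_comp_def M_def orthogonal_def by (auto simp: symB)
    finally show ?thesis .
  qed
  moreover have "\<exists>!d. d - y \<in> M \<and> z - d \<in> M\<^sup>\<bottom>" for y z
  proof -
    obtain m n where m: "m \<in> span M" and n: "\<And>w. w \<in> span M \<Longrightarrow> orthogonal n w" and zy: "z - y = m + n"
      using orthogonal_subspace_decomp_exists by blast
    have "n \<in> M\<^sup>\<bottom>"
      using n unfolding orthogonal_comp_def by (auto simp: orthogonal_commute span_base)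
    moreover have "z - (y + m) = n" using zy by (simp add: algebra_simps)
    ultimately have "(y + m) - y \<in> M \<and> z - (y + m) \<in> M\<^sup>\<bottom>" using m M by (simp add: span_eq_iff[THEN iffD2])
    \<comment> \<open>The difference of two solutions lies in M and in its orthogonal
      complement.\<close>
    moreover have "d = d'" if "d - y \<in> M \<and> z - d \<in> M\<^sup>\<bottom>" "d' - y \<in> M \<and> z - d' \<in> M\<^sup>\<bottom>" for d d'
    proof -
      have "(d - y) - (d' - y) \<in> M" using that by (blast intro: subspace_diff[OF M])
      moreover have "(z - d') - (z - d) \<in> M\<^sup>\<bottom>" 
        using that by (blast intro: subspace_diff[OF subspace_orthogonal_comp])
      ultimately have "orthogonal (d - d') (d - d')" by (simp add: orthogonal_comp_def)
      then show ?thesis by (simp add: orthogonal_def)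
    qed
    ultimately show ?thesis by blast
  qed
  ultimately show ?thesis by simp
qed

section \<open>The Newton direction\<close>

lemma mem_translate_iff: "v \<in> (+) a ` S \<longleftrightarrow> v - a \<in> S" for a :: "'a::ab_group_add"
  by (auto simp: image_iff algebra_simps intro: bexI[of _ "v - a"])

lemma scaleR_mem_translate_iff:
  assumes S: "subspace S" and r: "r \<noteq> 0"
  shows "r *\<^sub>R v \<in> (+) a ` S \<longleftrightarrow> v \<in> (+) ((1 / r) *\<^sub>R a) ` S"
proof -
  have 1: "r *\<^sub>R v - a = r *\<^sub>R (v - (1 / r) *\<^sub>R a)" using r by (simp add: scaleR_diff_right)
  have "r *\<^sub>R y \<in> S \<longleftrightarrow> y \<in> S" for y
    using subspace_scale[OF S, of y r] subspace_scale[OF S, of "r *\<^sub>R y" "inverse r"] r by auto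
  then show ?thesis unfolding mem_translate_iff 1 .
qed

lemma inv_eqI:
  assumes "\<And>v. f (g v) = v" "\<And>v. g (f v) = v"
  shows "inv f = g"
  using assms by (intro inv_unique_comp) auto

text \<open>All elements involved are diagonal in one frame of w, so each claim reduces to a scalar
  identity on the eigenvalues. These are positive, which keeps clear of the conventional values of
  \<open>inverse\<close> and \<open>sqrt\<close>.\<close>

lemma jsqrt_system:
  fixes w :: "'a::euclidean_jordan_algebra"
  assumes w: "w \<in> interior cone_of_squares"
  shows "quad_rep (jsqrt w) (quad_rep (jinv_sqrt w) v) = v"
    and "quad_rep (jinv_sqrt w) (quad_rep (jsqrt w) v) = v"
    and "quad_rep (jsqrt w) (quad_rep (jsqrt w) v) = quad_rep w v"
    and "quad_rep (jinv_sqrt w) (quad_rep (jinv_sqrt w) v) = quad_rep (jinv w) v"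
    and "quad_rep (jsqrt w) \<e> = w" and "quad_rep (jinv_sqrt w) \<e> = jinv w"
    and "psd_operator (quad_rep (jsqrt w))" and "psd_operator (quad_rep (jinv_sqrt w))"
proof -
  obtain C l where dec: "spectral_decomp w C l" by (rule spectral_decomp_exists)
  have C: "orthogonal_idempotents C" "\<Sum>C = \<e>" and wl: "w = (\<Sum>c\<in>C. l c *\<^sub>R c)"
    using dec jordan_frame_orthogonal_idempotents by (auto simp: spectral_decomp_def)
  have pos: "0 < l c" if "c \<in> C" for c using spectral_decomp_interior_pos[OF w dec that] .
  have sq: "jsqrt w = (\<Sum>c\<in>C. sqrt (l c) *\<^sub>R c)"
    and isq: "jinv_sqrt w = (\<Sum>c\<in>C. inverse (sqrt (l c)) *\<^sub>R c)"
    and inv: "jinv w = (\<Sum>c\<in>C. inverse (l c) *\<^sub>R c)"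
    unfolding jsqrt_def jinv_sqrt_def jinv_def by (rule spectral_map_eq[OF dec])+
  have 1: "(\<Sum>c\<in>C. (sqrt (l c) * inverse (sqrt (l c))) *\<^sub>R c) = \<e>"
    "(\<Sum>c\<in>C. (inverse (sqrt (l c)) * sqrt (l c)) *\<^sub>R c) = \<e>"
    unfolding C(2)[symmetric] by (intro sum.cong refl, use pos in force)+
  have 2: "(\<Sum>c\<in>C. (sqrt (l c) * sqrt (l c)) *\<^sub>R c) = w"
    unfolding wl by (intro sum.cong refl) (use pos in \<open>auto simp: less_imp_le\<close>)
  have 3: "(\<Sum>c\<in>C. (inverse (sqrt (l c)) * inverse (sqrt (l c))) *\<^sub>R c) = jinv w"
    unfolding inv by (intro sum.cong refl)
      (use pos in \<open>auto simp: less_imp_le simp flip: inverse_mult_distrib\<close>)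
  show "quad_rep (jsqrt w) (quad_rep (jinv_sqrt w) v) = v"
    "quad_rep (jinv_sqrt w) (quad_rep (jsqrt w) v) = v"
    "quad_rep (jsqrt w) (quad_rep (jsqrt w) v) = quad_rep w v"
    "quad_rep (jinv_sqrt w) (quad_rep (jinv_sqrt w) v) = quad_rep (jinv w) v"
    unfolding sq isq quad_rep_compose[OF C(1)] 1 2 3 by (simp_all add: quad_rep_jone)
  show "quad_rep (jsqrt w) \<e> = w" "quad_rep (jinv_sqrt w) \<e> = jinv w"
    unfolding quad_rep_of_jone sq isq orthogonal_idempotents_product[OF C(1)] 2 3 by simp_all
  show "psd_operator (quad_rep (jsqrt w))" "psd_operator (quad_rep (jinv_sqrt w))"
    unfolding sq isq by (intro psd_quad_rep[OF C(1)], simp add: pos less_imp_le)+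
qed

lemma inv_quad_rep_scaleR:
  fixes u :: "'a::euclidean_jordan_algebra"
  assumes r: "r \<noteq> 0" and inv: "\<And>v. A (B v) = v" "\<And>v. B (A v) = v"
    and Q: "\<And>v. A (A v) = quad_rep u v"
  shows "inv (quad_rep (r *\<^sub>R u)) v = (1 / r\<^sup>2) *\<^sub>R B (B v)"
proof -
  have lin: "linear (quad_rep u)" by (rule linear_quad_rep)
  have "B (B (quad_rep u v)) = v" "quad_rep u (B (B v)) = v" for v
    using inv by (simp_all flip: Q)
  then have "quad_rep (r *\<^sub>R u) ((\<lambda>v. B (B ((1 / r\<^sup>2) *\<^sub>R v))) v) = v"
    "(\<lambda>v. B (B ((1 / r\<^sup>2) *\<^sub>R v))) (quad_rep (r *\<^sub>R u) v) = v" for v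
    using r by (simp_all add: quad_rep_scaleR)
  then have "inv (quad_rep (r *\<^sub>R u)) = (\<lambda>v. B (B ((1 / r\<^sup>2) *\<^sub>R v)))" by (rule inv_eqI)
  \<comment> \<open>B is not assumed linear; homogeneity of its square is inherited from
    \<open>quad_rep u\<close>, whose inverse it is.\<close>
  moreover have "B (B (t *\<^sub>R v)) = t *\<^sub>R B (B v)" for t v
  proof -
    have "quad_rep u (t *\<^sub>R B (B v)) = t *\<^sub>R v"
      using \<open>\<And>v. quad_rep u (B (B v)) = v\<close> by (simp add: linear_scale[OF lin])
    then show ?thesis by (metis \<open>\<And>v. B (B (quad_rep u v)) = v\<close>)
  qed
  ultimately show ?thesis by simp
qed

text \<open>By uniqueness of the root, B / r is the square root of the inverse of Q(r u). Keeping A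
  and B abstract lets the lemma serve x, and s with the two operators exchanged.\<close>

lemma local_norm_scaleR:
  fixes u :: "'a::euclidean_jordan_algebra"
  assumes r: "r > 0" and inv: "\<And>v. A (B v) = v" "\<And>v. B (A v) = v"
    and Q: "\<And>v. A (A v) = quad_rep u v" and B: "psd_operator B"
  shows "local_norm (r *\<^sub>R u) v = norm (B v) / r"
proof -
  have linB: "linear B" using B by (simp add: psd_operator_def)
  have "operator_sqrt (inv (quad_rep (r *\<^sub>R u))) = (\<lambda>v. (1 / r) *\<^sub>R B v)"
  proof (rule operator_sqrt_eqI)
    show "psd_operator (\<lambda>v. (1 / r) *\<^sub>R B v)"
      using B r by (auto simp: psd_operator_def intro: linear_compose_scale_right)
    show "(1 / r) *\<^sub>R B ((1 / r) *\<^sub>R B x) = inv (quad_rep (r *\<^sub>R u)) x" for x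
      using r inv_quad_rep_scaleR[OF _ inv Q, of r x]
      by (simp add: linear_scale[OF linB] power2_eq_square)
  qed
  then show ?thesis using r by (simp add: local_norm_def)
qed

theorem proposition2p3:
  fixes L :: "'a::euclidean_jordan_algebra set"
    and x\<^sub>0 s\<^sub>0 w d x s d\<^sub>x d\<^sub>s :: 'a
    and \<mu> :: real and n :: nat
  assumes rank: "jrank TYPE('a) = n"
    and L: "subspace L"
    and slater_primal: "interior cone_of_squares \<inter> (+) x\<^sub>0 ` L \<noteq> {}"
    and slater_dual: "interior cone_of_squares \<inter> (+) s\<^sub>0 ` (L\<^sup>\<bottom>) \<noteq> {}"
    and w: "w \<in> interior cone_of_squares"
    and \<mu>: "\<mu> > 0"
    and d: "d = newton_direction L x\<^sub>0 s\<^sub>0 w \<mu>"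
    and x: "x = sqrt \<mu> *\<^sub>R w"
    and s: "s = sqrt \<mu> *\<^sub>R jinv w"
    and d\<^sub>x: "d\<^sub>x = sqrt \<mu> *\<^sub>R quad_rep (jsqrt w) d"
    and d\<^sub>s: "d\<^sub>s = - (sqrt \<mu> *\<^sub>R quad_rep (jinv_sqrt w) d)"
  shows "(\<forall>p q. x + p \<in> (+) x\<^sub>0 ` L \<and> s + q \<in> (+) s\<^sub>0 ` (L\<^sup>\<bottom>) \<and>
                 q = - (\<mu> *\<^sub>R inv (quad_rep x) p)
             \<longleftrightarrow> p = d\<^sub>x \<and> q = d\<^sub>s) \<and>
         norm d = local_norm x d\<^sub>x \<and>
         norm d = local_norm s d\<^sub>s"
proof -
  define m where "m = sqrt \<mu>"
  define A B where "A = quad_rep (jsqrt w)" and "B = quad_rep (jinv_sqrt w)"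
  have m: "m > 0" "m * m = \<mu>" using \<mu> by (auto simp: m_def)
  note sys = jsqrt_system[OF w, folded A_def B_def]
  have AB: "A (B v) = v" and BA: "B (A v) = v" and AA: "A (A v) = quad_rep w v"
    and BB: "B (B v) = quad_rep (jinv w) v" for v
    using sys by auto
  have lin: "linear A" "linear B" by (simp_all add: A_def B_def linear_quad_rep)
  have primal: "m *\<^sub>R A (\<e> + y) = x + m *\<^sub>R A y" for y
    by (simp add: linear_add[OF lin(1)] sys x m_def[symmetric] scaleR_add_right)
  have dual: "m *\<^sub>R B (\<e> - y) = s - m *\<^sub>R B y" for y
    by (simp add: linear_diff[OF lin(2)] sys s m_def[symmetric] scaleR_diff_right)
  define N where "N y \<longleftrightarrow> A (\<e> + y) \<in> (+) ((1 / m) *\<^sub>R x\<^sub>0) ` L \<and>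
    B (\<e> - y) \<in> (+) ((1 / m) *\<^sub>R s\<^sub>0) ` (L\<^sup>\<bottom>)" for y
  have ex1: "\<exists>!y. N y"
    unfolding N_def
    by (rule newton_system_unique_solution[OF L lin AB BA]) (simp add: B_def quad_rep_symmetric)
  have d_eq: "d = (THE y. N y)"
    unfolding d newton_direction_def N_def m_def A_def B_def ..
  have N_iff: "N y \<longleftrightarrow> y = d" for y
    using theI'[OF ex1] ex1 unfolding d_eq by blast
  \<comment> \<open>Multiplying both Newton conditions by m moves them to the unscaled affine
    spaces.\<close>
  have N_alt: "N y \<longleftrightarrow> x + m *\<^sub>R A y \<in> (+) x\<^sub>0 ` L \<and> s - m *\<^sub>R B y \<in> (+) s\<^sub>0 ` (L\<^sup>\<bottom>)" for y
    unfolding N_def primal[symmetric] dual[symmetric] using m L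
    by (simp add: scaleR_mem_translate_iff subspace_orthogonal_comp)
  \<comment> \<open>Since x = m w, the inverse of Q(x) carries a factor 1 / (m m), which cancels the
    factor \<open>\<mu>\<close>.\<close>
  have invQ: "\<mu> *\<^sub>R inv (quad_rep x) p = B (B p)" for p
    using inv_quad_rep_scaleR[OF _ AB BA AA, of m p] m \<mu> unfolding x m_def[symmetric]
    by (simp add: power2_eq_square)
  have "(x + p \<in> (+) x\<^sub>0 ` L \<and> s + q \<in> (+) s\<^sub>0 ` (L\<^sup>\<bottom>) \<and> q = - (\<mu> *\<^sub>R inv (quad_rep x) p))
      \<longleftrightarrow> (p = d\<^sub>x \<and> q = d\<^sub>s)" for p q
  proof -
    \<comment> \<open>In this variable p = m A y, and the equation for q becomes q = - m B y, so the
      system for p and q is exactly \<open>N y\<close>.\<close>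
    define y where "y = (1 / m) *\<^sub>R B p"
    have By: "m *\<^sub>R B y = B (B p)" using m by (simp add: y_def linear_scale[OF lin(2)])
    have Ay: "p = m *\<^sub>R A y" using m by (simp add: y_def linear_scale[OF lin(1)] AB)
    have "y = d \<longleftrightarrow> p = d\<^sub>x"
    proof
      assume "p = d\<^sub>x"
      then show "y = d"
        using m by (simp add: y_def d\<^sub>x m_def[symmetric] A_def[symmetric] linear_scale[OF lin(2)] BA)
    qed (simp add: Ay d\<^sub>x m_def A_def)
    moreover have "d\<^sub>s = - (m *\<^sub>R B d)" by (simp add: d\<^sub>s m_def B_def)
    ultimately show ?thesis
      using N_iff[of y] N_alt[of y] unfolding invQ By[symmetric] Ay[symmetric] by auto
  qed
  moreover have "norm d = local_norm x d\<^sub>x"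
    using local_norm_scaleR[OF m(1) AB BA AA sys(8), of d\<^sub>x] m
    by (simp add: x d\<^sub>x m_def[symmetric] A_def[symmetric] linear_scale[OF lin(2)] BA)
  \<comment> \<open>For s the base point is \<open>jinv w\<close>, the square of B, so A and B
    change roles; the sign in \<open>d\<^sub>s\<close> disappears under the norm.\<close>
  moreover have "norm d = local_norm s d\<^sub>s"
    using local_norm_scaleR[OF m(1) BA AB BB sys(7), of d\<^sub>s] m
    by (simp add: s d\<^sub>s m_def[symmetric] B_def[symmetric] linear_scale[OF lin(1)]
        linear_neg[OF lin(1)] AB)
  ultimately show ?thesis by blast
qed

end
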